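(* Let $\lambda\in(0,1)$ and consider the auxiliary Markov decision process $(\hat S,\hat A,\hat P,\hat r_1)$ described in the context, with reward function $\hat r_1((i,j),a)=1$ if $(i,j)=(L,L)$ and $\hat r_1((i,j),a)=0$ otherwise. A stationary and deterministic policy $\pi^*=(d^* )^\infty$ is optimal in this Markov decision process if and only if $d^*(i,j)\in A^*(i,j)$ for all $(i,j)\in\hat S$, where the function $A^*$ from $\hat S$ to the power set of $\hat A$ is defined by $$A^*(i,j)=\begin{cases}\{b_1\}, & \text{if } i=L,\ j=2,\ldots,L-2,\\ \{b_2\}, & \text{if } i=2,\ldots,L-2,\ j=L,\\ \{b_1,b_2\}, & \text{if } i,j=2,\ldots,L-2,\end{cases}$$ and $A^*(L,L)=\{0\}$.
   Context: $L$ is a fixed, arbitrarily large integer. State space: $\hat S=\{(i,j): i,j\in\{2,3,\ldots,L-2\}\cup\{L\}\}$ (the state $(i,j)$ represents a rectangular particle cluster of size $i\times j$ in a box). Action spaces, with actions denoted by the symbols $0,b_1,b_1',b_2,b_2'$: - $\hat A(L,L)=\{0\}$; - $\hat A(L,j)=\{b_1\}$ for $2\le j\le L-2$; - $\hat A(i,L)=\{b_2\}$ for $2\le i\le L-2$; - $\hat A(2,j)=\{b_1',b_2,b_2'\}$ for $3\le j\le L-2$; - $\hat A(i,2)=\{b_1,b_1',b_2'\}$ for $3\le i\le L-2$; - $\hat A(2,2)=\{b_1',b_2'\}$; - $\hat A(i,j)=\{b_1,b_1',b_2,b_2'\}$ for $3\le i,j\le L-2$. Put $\hat A=\bigcup_{(i,j)\in\hat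 S}\hat A(i,j)$. Transition probabilities $\hat P(\cdot\mid(i,j),a)$ (for $(i,j)\in\hat S$; all unlisted transitions have probability $0$): - $a=b_1$, $i\in\{3,\ldots,L-2,L\}$, $2\le j\le L-3$: to $(i,j)$ w.p. $2/7$, to $(i,j+1)$ w.p. $5/7$. - $a=b_2$, $2\le i\le L-3$, $j\in\{3,\ldots,L-2,L\}$: to $(i,j)$ w.p. $2/7$, to $(i+1,j)$ w.p. $5/7$. - $a=b_1'$, $2\le i\le L-2$, $i\le j\le L-3$: to $(i,j)$ w.p. $1/2$, to $(i,j+1)$ w.p. $1/2$. - $a=b_1'$, $2\le i\le L-2$, $2\le j\le i-1$: to $(i,j)$ w.p. $1/2$, to $(i,j+1)$ w.p. $1/3$, to $(i-1,j+1)$ w.p. $1/6$. - $a=b_2'$, $2\le j\le L-2$, $j\le i\le L-3$: to $(i,j)$ w.p. $1/2$, to $(i+1,j)$ w.p. $1/2$. - $a=b_2'$, $2\le j\le L-2$, $2\le i\le j-1$: to $(i,j)$ w.p. $1/2$, to $(i+1,j)$ w.p. $1/3$, to $(i+1,j-1)$ w.p. $1/6$. - $a=b_1$, state $(i,L-2)$, $i\in\{3,\ldots,L-2,L\}$: to $(i,L-2)$ w.p. $1/7$, to $(i,L)$ w.p. $6/7$. - $a=b_2$, state $(L-2,j)$, $j\in\{3,\ldots,L-2,L\}$: to $(L-2,j)$ w.p. $1/7$, to $(L,j)$ w.p. $6/7$. - $a=b_1'$, state $(i,L-2)$, $2\le i\le L-2$: to $(i,L-2)$ w.p. $1/3$,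 to $(i,L)$ w.p. $2/3$. - $a=b_2'$, state $(L-2,j)$, $2\le j\le L-2$: to $(L-2,j)$ w.p. $1/3$, to $(L,j)$ w.p. $2/3$. - $a=0$ (do nothing), state $(L,L)$: stays at $(L,L)$ w.p. $1$. Policies and optimality: a decision rule is a map $d:\hat S\to\hat A$ prescribing an action $d(s)\in\hat A(s)$ for each state $s$; the stationary deterministic policy $\pi=(d)^\infty$ uses $d$ at every decision epoch $t=1,2,\ldots$. Let $\Pi$ be the set of all such policies. For a reward function $r$, the value function of $\pi$ is $v^\pi_\lambda(s)=\mathbb E^\pi_s\big[\sum_{t=1}^\infty\lambda^{t-1}r(X_t^\pi,Y_t^\pi)\big]$, where $X_t^\pi$ is the state and $Y_t^\pi=d(X_t^\pi)$ the selected action at epoch $t$, and $s=X^\pi_1$ is the initial state. The policy $\pi^*\in\Pi$ is optimal if $v_\lambda^{\pi^*}(s)\ge v_\lambda^\pi(s)$ for all $s\in\hat S$ and all $\pi\in\Pi$.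
   Formalization: The condition d*(i,j) ∈ A*(i,j) is not required at (2,2): there A*(2,2)={b1,b2} is disjoint from the admissible set {b1',b2'}, so the claim as written fails; both admissible actions at (2,2) are optimal. L ≥ 4 is assumed. *)

theory Defs
  imports "HOL-Probability.Probability"
begin

section \<open>Discounted Markov decision processes with stationary deterministic policies\<close>

definition decision_rules :: "'s set \<Rightarrow> ('s \<Rightarrow> 'a set) \<Rightarrow> ('s \<Rightarrow> 'a) set" where
  "decision_rules S A = (\<Pi> s\<in>S. A s)"

text \<open>
  Law of the state at time \<open>t\<close> given the states \<open>\<omega> 0, \<dots>, \<omega> (t - 1)\<close>, when the decision rule \<open>d\<close>
  is used at every epoch. Epochs are counted from \<open>0\<close>, so \<open>\<omega> t\<close> is the state at epoch
  \<open>t + 1\<close> in the convention with epochs \<open>1, 2, \<dots>\<close>.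
\<close>

definition step_kernel ::
  "('s \<Rightarrow> 'a \<Rightarrow> 's pmf) \<Rightarrow> ('s \<Rightarrow> 'a) \<Rightarrow> 's \<Rightarrow> nat \<Rightarrow> (nat \<Rightarrow> 's) \<Rightarrow> 's measure" where
  "step_kernel P d s t \<omega> =
     measure_pmf (if t = 0 then return_pmf s else P (\<omega> (t - 1)) (d (\<omega> (t - 1))))"

text \<open>Law of the state trajectory started in \<open>s\<close>, as given by the Ionescu-Tulcea theorem.\<close>

definition path_measure ::
  "('s \<Rightarrow> 'a \<Rightarrow> 's pmf) \<Rightarrow> ('s \<Rightarrow> 'a) \<Rightarrow> 's \<Rightarrow> (nat \<Rightarrow> 's) measure" where
  "path_measure P d s =
     projective_family.lim UNIV
       (Ionescu_Tulcea.CI (step_kernel P d s) (\<lambda>_. count_space UNIV)) (\<lambda>_. count_space UNIV)"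

definition policy_value ::
  "('s \<Rightarrow> 'a \<Rightarrow> 's pmf) \<Rightarrow> ('s \<Rightarrow> 'a \<Rightarrow> real) \<Rightarrow> real \<Rightarrow> ('s \<Rightarrow> 'a) \<Rightarrow> 's \<Rightarrow> real" where
  "policy_value P r l d s =
     (\<integral>\<omega>. (\<Sum>t. l ^ t * r (\<omega> t) (d (\<omega> t))) \<partial>path_measure P d s)"

definition optimal_policy ::
  "'s set \<Rightarrow> ('s \<Rightarrow> 'a set) \<Rightarrow> ('s \<Rightarrow> 'a \<Rightarrow> 's pmf) \<Rightarrow> ('s \<Rightarrow> 'a \<Rightarrow> real) \<Rightarrow> real \<Rightarrow>
    ('s \<Rightarrow> 'a) \<Rightarrow> bool" where
  "optimal_policy S A P r l d \<longleftrightarrow>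
     d \<in> decision_rules S A \<and>
     (\<forall>s\<in>S. \<forall>d'\<in>decision_rules S A. policy_value P r l d' s \<le> policy_value P r l d s)"

lemma Ionescu_Tulcea_step_kernel:
  fixes P :: "'s::countable \<Rightarrow> 'a \<Rightarrow> 's pmf"
  shows "Ionescu_Tulcea (step_kernel P d s) (\<lambda>_. count_space UNIV)"
proof (rule Ionescu_Tulcea.intro)
  fix t :: nat
  show "step_kernel P d s t \<in> PiM {0..<t} (\<lambda>_. count_space UNIV) \<rightarrow>\<^sub>M subprob_algebra (count_space UNIV)"
  proof (cases t)
    case 0
    then show ?thesis
      by (auto simp: step_kernel_def[abs_def] space_subprob_algebra
          intro!: measurable_const measure_pmf.subprob_space_axioms)
  next
    case (Suc n)
    have "(\<lambda>\<omega>. \<omega> n) \<in> PiM {0..<t} (\<lambda>_. count_space UNIV) \<rightarrow>\<^sub>M (count_space UNIV :: 's measure)"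
      using Suc by (intro measurable_component_singleton) auto
    moreover have "(\<lambda>x. measure_pmf (P x (d x))) \<in> count_space UNIV \<rightarrow>\<^sub>M subprob_algebra (count_space UNIV)"
      by (auto simp: space_subprob_algebra intro!: measure_pmf.subprob_space_axioms)
    ultimately have "(\<lambda>\<omega>. measure_pmf (P (\<omega> n) (d (\<omega> n))))
        \<in> PiM {0..<t} (\<lambda>_. count_space UNIV) \<rightarrow>\<^sub>M subprob_algebra (count_space UNIV)"
      by (rule measurable_compose)
    then show ?thesis
      using Suc by (simp add: step_kernel_def[abs_def])
  qed
next
  fix t :: nat and \<omega> :: "nat \<Rightarrow> 's"
  show "prob_space (step_kernel P d s t \<omega>)"
    by (simp add: step_kernel_def measure_pmf.prob_space_axioms)
qed

lemma prob_space_path_measure: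
  fixes P :: "'s::countable \<Rightarrow> 'a \<Rightarrow> 's pmf"
  shows "prob_space (path_measure P d s)"
proof -
  interpret IT: Ionescu_Tulcea "step_kernel P d s" "\<lambda>_. count_space UNIV"
    by (rule Ionescu_Tulcea_step_kernel)
  have eq: "path_measure P d s = IT.PF.lim"
    by (simp add: path_measure_def)
  have "prob_space (distr IT.PF.lim (PiM {} (\<lambda>_. count_space UNIV)) (\<lambda>x. restrict x {}))"
    using IT.PF.prob_space_P[of "{}"] by (subst IT.distr_lim) auto
  then show ?thesis
    unfolding eq
    by (rule prob_space_distrD[rotated])
      (auto simp: measurable_cong_sets[OF IT.PF.sets_lim refl]
        intro!: measurable_restrict measurable_component_singleton)
qed


section \<open>The auxiliary cluster process\<close>

datatype action = Zero | B1 | B1' | B2 | B2'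

definition states :: "nat \<Rightarrow> (nat \<times> nat) set" where
  "states L = ({2..L-2} \<union> {L}) \<times> ({2..L-2} \<union> {L})"

fun actions :: "nat \<Rightarrow> nat \<times> nat \<Rightarrow> action set" where
  "actions L (i, j) =
    (if i = L \<and> j = L then {Zero}
     else if i = L then {B1}
     else if j = L then {B2}
     else if i = 2 \<and> j = 2 then {B1', B2'}
     else if i = 2 then {B1', B2, B2'}
     else if j = 2 then {B1, B1', B2'}
     else {B1, B1', B2, B2'})"

text \<open>
  The final \<open>return_pmf\<close> branch for each action is reached only for pairs outside the transition
  table: an inadmissible action or a pair that is not a state.
\<close>

fun transition :: "nat \<Rightarrow> nat \<times> nat \<Rightarrow> action \<Rightarrow> (nat \<times> nat) pmf" where
  "transition L (i, j) Zero = return_pmf (i, j)"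
| "transition L (i, j) B1 =
    (if i \<in> {3..L-2} \<union> {L} \<and> j \<in> {2..L-3} then
       pmf_of_list [((i, j), 2/7), ((i, j+1), 5/7)]
     else if i \<in> {3..L-2} \<union> {L} \<and> j = L-2 then
       pmf_of_list [((i, j), 1/7), ((i, L), 6/7)]
     else return_pmf (i, j))"
| "transition L (i, j) B2 =
    (if i \<in> {2..L-3} \<and> j \<in> {3..L-2} \<union> {L} then
       pmf_of_list [((i, j), 2/7), ((i+1, j), 5/7)]
     else if i = L-2 \<and> j \<in> {3..L-2} \<union> {L} then
       pmf_of_list [((i, j), 1/7), ((L, j), 6/7)]
     else return_pmf (i, j))"
| "transition L (i, j) B1' =
    (if i \<in> {2..L-2} \<and> j \<in> {i..L-3} then
       pmf_of_list [((i, j), 1/2), ((i, j+1), 1/2)]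
     else if i \<in> {2..L-2} \<and> j \<in> {2..i-1} then
       pmf_of_list [((i, j), 1/2), ((i, j+1), 1/3), ((i-1, j+1), 1/6)]
     else if i \<in> {2..L-2} \<and> j = L-2 then
       pmf_of_list [((i, j), 1/3), ((i, L), 2/3)]
     else return_pmf (i, j))"
| "transition L (i, j) B2' =
    (if j \<in> {2..L-2} \<and> i \<in> {j..L-3} then
       pmf_of_list [((i, j), 1/2), ((i+1, j), 1/2)]
     else if j \<in> {2..L-2} \<and> i \<in> {2..j-1} then
       pmf_of_list [((i, j), 1/2), ((i+1, j), 1/3), ((i+1, j-1), 1/6)]
     else if i = L-2 \<and> j \<in> {2..L-2} then
       pmf_of_list [((i, j), 1/3), ((L, j), 2/3)]
     else return_pmf (i, j))"

definition reward1 :: "nat \<Rightarrow> nat \<times> nat \<Rightarrow> action \<Rightarrow> real" where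
  "reward1 L s a = (if s = (L, L) then 1 else 0)"

text \<open>
  \<open>A_star L s\<close> is not contained in \<open>actions L s\<close> when \<open>s\<close> has a side of length \<open>2\<close>, since \<open>B1\<close>
  is inadmissible for \<open>i = 2\<close> and \<open>B2\<close> for \<open>j = 2\<close>. At \<open>(2, 2)\<close> the two sets are disjoint, so the
  condition \<open>d s \<in> A_star L s\<close> is satisfiable by a decision rule exactly when \<open>s \<noteq> (2, 2)\<close>. At
  \<open>(2, 2)\<close> the only admissible actions are \<open>B1'\<close> and \<open>B2'\<close>, which are interchanged by the symmetry
  \<open>(i, j) \<mapsto> (j, i)\<close>; a characterization of optimality has to leave that state unconstrained.
\<close>

fun A_star :: "nat \<Rightarrow> nat \<times> nat \<Rightarrow> action set" where
  "A_star L (i, j) =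
    (if i = L \<and> j = L then {Zero}
     else if i = L then {B1}
     else if j = L then {B2}
     else {B1, B2})"

lemma A_star_Int_actions_eq_empty_iff:
  assumes "4 \<le> L" "s \<in> states L"
  shows "A_star L s \<inter> actions L s = {} \<longleftrightarrow> s = (2, 2)"
  using assms by (cases s) (auto simp: states_def)

lemma set_transition_subset_states:
  assumes "4 \<le> L" "s \<in> states L"
  shows "set_pmf (transition L s a) \<subseteq> states L"
proof (cases s)
  case (Pair i j)
  have two: "set_pmf (pmf_of_list [(u, p), (v, q)]) \<subseteq> T \<longleftrightarrow> True"
    if "0 \<le> p" "0 \<le> q" "p + q = 1" "u \<in> T" "v \<in> T"
    for u v :: "nat \<times> nat" and p q :: real and T
  proof -
    have "pmf_of_list_wf [(u, p), (v, q)]"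
      using that by (simp add: pmf_of_list_wf_def)
    from set_pmf_of_list[OF this] that show ?thesis
      by auto
  qed
  have three: "set_pmf (pmf_of_list [(u, p), (v, q), (w, r)]) \<subseteq> T \<longleftrightarrow> True"
    if "0 \<le> p" "0 \<le> q" "0 \<le> r" "p + (q + r) = 1" "u \<in> T" "v \<in> T" "w \<in> T"
    for u v w :: "nat \<times> nat" and p q r :: real and T
  proof -
    have "pmf_of_list_wf [(u, p), (v, q), (w, r)]"
      using that by (simp add: pmf_of_list_wf_def)
    from set_pmf_of_list[OF this] that show ?thesis
      by auto
  qed
  have mem: "(x, y) \<in> states L \<longleftrightarrow>
      (2 \<le> x \<and> x + 2 \<le> L \<or> x = L) \<and> (2 \<le> y \<and> y + 2 \<le> L \<or> y = L)" for x y
    using assms(1) by (auto simp: states_def)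
  have ij: "(2 \<le> i \<and> i + 2 \<le> L \<or> i = L) \<and> (2 \<le> j \<and> j + 2 \<le> L \<or> j = L)"
    using assms(2) by (simp add: Pair mem)
  show ?thesis
    using assms(1) ij unfolding Pair
    by (cases a) (simp_all add: two three mem, (intro conjI impI; (subst two three)?; force simp: mem)+)
qed

end

theory Submission
  imports Defs
begin

text \<open>
  Under a rule choosing from \<^const>\<open>A_star\<close>, every unit of growth of a side takes an independent
  geometric waiting time, and the order in which the sides grow is immaterial. So the expected
  discount until \<open>(L, L)\<close> is a product of one factor per side. This product solves the
  optimality equation, and \<open>B1'\<close> and \<open>B2'\<close> are strictly worse away from \<open>(2, 2)\<close>: they grow
  more slowly, and a corner move from \<open>(i, j)\<close> to \<open>(i - 1, j + 1)\<close> leaves the product unchanged,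
  so it only costs time.
\<close>

section \<open>Marginal laws of the state process\<close>

primrec state_pmf :: "('s \<Rightarrow> 's pmf) \<Rightarrow> nat \<Rightarrow> 's \<Rightarrow> 's pmf" where
  "state_pmf K 0 s = return_pmf s"
| "state_pmf K (Suc t) s = bind_pmf (state_pmf K t s) K"

text \<open>The definition appends the newest step, as the path measure is built; conditioning on
  the first step is the form that a Bellman equation needs.\<close>

lemma state_pmf_Suc_left: "state_pmf K (Suc t) s = bind_pmf (K s) (state_pmf K t)"
proof (induction t)
  case 0
  then show ?case by (simp add: bind_return_pmf bind_return_pmf')
next
  case (Suc t)
  have "state_pmf K (Suc (Suc t)) s = bind_pmf (bind_pmf (K s) (state_pmf K t)) K"
    by (simp only: state_pmf.simps(2)[of _ "Suc t"] Suc)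
  then show ?case by (simp add: bind_assoc_pmf)
qed

text \<open>The projective limit, restricted to epochs up to \<open>t\<close>, is a finite iterate
  \<open>IT.C\<close> of the kernels. There the marginals obey the Markov recursion, because each
  kernel reads only the latest state.\<close>

lemma distr_path_measure:
  fixes P :: "'s::countable \<Rightarrow> 'a \<Rightarrow> 's pmf"
  shows "distr (path_measure P d s) (count_space UNIV) (\<lambda>\<omega>. \<omega> t) =
    measure_pmf (state_pmf (\<lambda>x. P x (d x)) t s)"
proof -
  interpret IT: Ionescu_Tulcea "step_kernel P d s" "\<lambda>_. count_space UNIV"
    by (rule Ionescu_Tulcea_step_kernel)
  let ?u = "\<lambda>_. undefined :: 's" and ?K = "\<lambda>x. P x (d x)"
  let ?M = "\<lambda>n. PiM {0..<n} (\<lambda>_. count_space UNIV :: 's measure)"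
  \<comment> \<open>The index set \<open>{0..<0}\<close> is empty, so the history before the first
    epoch is the everywhere undefined function.\<close>
  have u: "?u \<in> space (?M 0)"
    by (simp add: space_PiM PiE_def extensional_def)
  have coord: "(\<lambda>\<omega>. \<omega> t) \<in> ?M (Suc t) \<rightarrow>\<^sub>M count_space UNIV" for t
    by (rule measurable_component_singleton) simp
  have eP: "distr (IT.eP t \<omega>) (count_space UNIV) (\<lambda>\<omega>. \<omega> t) = step_kernel P d s t \<omega>"
    if "\<omega> \<in> space (?M t)" for t \<omega>
  proof -
    \<comment> \<open>Undefinedness outside the index set makes the update at \<open>t\<close> a
      point of the product space of histories of length \<open>Suc t\<close>.\<close>
    have undef: "\<omega> x = undefined" if "\<not> x < Suc t" for x
      using \<open>\<omega> \<in> space (?M t)\<close> that by (simp add: space_PiM PiE_def extensional_def)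
    have upd: "fun_upd \<omega> t \<in> step_kernel P d s t \<omega> \<rightarrow>\<^sub>M ?M (Suc t)"
      using that by (auto intro!: measurable_fun_upd[where J="{0..<t}"] simp: undef IT.sets_P space_PiM step_kernel_def)
    show ?thesis
      unfolding IT.eP_def using upd
      by (subst distr_distr[OF coord]) (auto simp: comp_def step_kernel_def intro!: distr_id2)
  qed
  have C_Suc: "distr (IT.C 0 (Suc t) ?u) (count_space UNIV) (\<lambda>\<omega>. \<omega> t) =
      IT.C 0 t ?u \<bind> step_kernel P d s t" for t
  proof -
    have ne: "space (IT.C 0 t ?u) \<noteq> {}"
      using IT.prob_space_C[OF u] by (rule prob_space.not_empty)
    have meas: "IT.eP t \<in> IT.C 0 t ?u \<rightarrow>\<^sub>M subprob_algebra (?M (Suc t))"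
      using IT.measurable_eP[of t] by (simp add: measurable_cong_sets[OF IT.sets_C[OF u] refl])
    have "distr (IT.C 0 (Suc t) ?u) (count_space UNIV) (\<lambda>\<omega>. \<omega> t) =
        IT.C 0 t ?u \<bind> (\<lambda>\<omega>. distr (IT.eP t \<omega>) (count_space UNIV) (\<lambda>\<omega>. \<omega> t))"
      using distr_bind[OF meas ne coord] by simp
    also have "\<dots> = IT.C 0 t ?u \<bind> step_kernel P d s t"
      by (rule bind_cong) (auto simp: IT.space_C[OF u] eP)
    finally show ?thesis .
  qed
  \<comment> \<open>Coordinate \<open>t\<close> is created at stage \<open>Suc t\<close>, hence the
    shift between \<open>IT.C\<close> and \<open>state_pmf\<close>.\<close>
  have C: "distr (IT.C 0 (Suc t) ?u) (count_space UNIV) (\<lambda>\<omega>. \<omega> t) =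
      measure_pmf (state_pmf ?K t s)" for t
  proof (induction t)
    case 0
    have "distr (IT.C 0 (Suc 0) ?u) (count_space UNIV) (\<lambda>\<omega>. \<omega> 0) = step_kernel P d s 0 ?u"
      unfolding C_Suc IT.C.simps(1) by (rule bind_return[OF IT.P u])
    also have "\<dots> = measure_pmf (state_pmf ?K 0 s)"
      by (simp add: step_kernel_def)
    finally show ?case .
  next
    case (Suc t)
    have coord': "(\<lambda>\<omega>. \<omega> t) \<in> IT.C 0 (Suc t) ?u \<rightarrow>\<^sub>M count_space UNIV"
      using coord[of t] by (simp add: measurable_cong_sets[OF IT.sets_C[OF u] refl] del: IT.C.simps)
    have ne: "space (IT.C 0 (Suc t) ?u) \<noteq> {}"
      using IT.prob_space_C[OF u] by (rule prob_space.not_empty)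
    have K: "(\<lambda>x. measure_pmf (?K x)) \<in> count_space UNIV \<rightarrow>\<^sub>M subprob_algebra (count_space UNIV)"
      by (rule measurable_measure_pmf)
    \<comment> \<open>The kernel at \<open>Suc t\<close> depends on the history only through
      \<open>\<omega> t\<close>, so the bind factors through the marginal at
      \<open>t\<close>.\<close>
    have "distr (IT.C 0 (Suc (Suc t)) ?u) (count_space UNIV) (\<lambda>\<omega>. \<omega> (Suc t)) =
        IT.C 0 (Suc t) ?u \<bind> (\<lambda>\<omega>. measure_pmf (?K (\<omega> t)))"
      unfolding C_Suc by (simp add: step_kernel_def[abs_def])
    also have "\<dots> = distr (IT.C 0 (Suc t) ?u) (count_space UNIV) (\<lambda>\<omega>. \<omega> t) \<bind> (\<lambda>x. measure_pmf (?K x))"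
      by (rule bind_distr[OF coord' K ne, symmetric])
    also have "\<dots> = measure_pmf (state_pmf ?K (Suc t) s)"
      unfolding Suc by (simp add: measure_pmf_bind)
    finally show ?case .
  qed
  let ?J = "{0..<Suc t}"
  \<comment> \<open>\<open>IT.up_to ?J\<close> is the length of the shortest history covering
    \<open>?J\<close>; it selects the \<open>IT.C\<close> that defines the finite-dimensional law on
    \<open>?J\<close>.\<close>
  have up_to: "IT.up_to ?J = Suc t"
    using IT.up_to_iff[of ?J "Suc t"] IT.up_to_less[of ?J t] by auto
  have restr: "(\<lambda>\<omega>. restrict \<omega> ?J) \<in> IT.PF.lim \<rightarrow>\<^sub>M ?M (Suc t)"
    by (simp add: measurable_cong_sets[OF IT.PF.sets_lim refl] measurable_restrict_subset)
  have restr_C: "(\<lambda>\<omega>. restrict \<omega> ?J) \<in> IT.C 0 (Suc t) ?u \<rightarrow>\<^sub>M ?M (Suc t)"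
    using measurable_restrict_subset[of ?J ?J "\<lambda>_. count_space UNIV :: 's measure"]
    by (simp add: measurable_cong_sets[OF IT.sets_C[OF u] refl] del: IT.C.simps)
  have "distr (path_measure P d s) (count_space UNIV) (\<lambda>\<omega>. \<omega> t) =
      distr (distr IT.PF.lim (?M (Suc t)) (\<lambda>\<omega>. restrict \<omega> ?J)) (count_space UNIV) (\<lambda>\<omega>. \<omega> t)"
    by (subst distr_distr[OF coord restr]) (simp add: path_measure_def comp_def)
  also have "\<dots> = distr (IT.C 0 (Suc t) ?u) (count_space UNIV) (\<lambda>\<omega>. \<omega> t)"
    unfolding IT.distr_lim[of ?J, simplified] IT.CI_def up_to
    by (subst distr_distr[OF coord restr_C]) (simp add: comp_def)
  finally show ?thesis unfolding C .
qed

lemma measurable_path_measure_coordinate: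
  fixes P :: "'s::countable \<Rightarrow> 'a \<Rightarrow> 's pmf"
  shows "(\<lambda>\<omega>. \<omega> t) \<in> path_measure P d s \<rightarrow>\<^sub>M count_space UNIV"
proof -
  interpret IT: Ionescu_Tulcea "step_kernel P d s" "\<lambda>_. count_space UNIV"
    by (rule Ionescu_Tulcea_step_kernel)
  show ?thesis
    by (simp add: path_measure_def measurable_cong_sets[OF IT.PF.sets_lim refl])
qed

lemma integral_path_measure:
  fixes P :: "'s::countable \<Rightarrow> 'a \<Rightarrow> 's pmf" and f :: "'s \<Rightarrow> real"
  shows "(\<integral>\<omega>. f (\<omega> t) \<partial>path_measure P d s) =
    measure_pmf.expectation (state_pmf (\<lambda>x. P x (d x)) t s) f"
  unfolding distr_path_measure[symmetric]
  by (subst integral_distr[OF measurable_path_measure_coordinate]) auto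

section \<open>Expectations of bounded functions\<close>

lemma integrable_pmf_bounded:
  fixes f :: "'a \<Rightarrow> real"
  assumes "\<And>x. \<bar>f x\<bar> \<le> B"
  shows "integrable (measure_pmf p) f"
  using assms by (intro measure_pmf.integrable_const_bound[where B = B]) auto

lemma abs_expectation_pmf_le:
  fixes f :: "'a \<Rightarrow> real"
  assumes "\<And>x. \<bar>f x\<bar> \<le> B"
  shows "\<bar>measure_pmf.expectation p f\<bar> \<le> B"
proof -
  have "\<bar>measure_pmf.expectation p f\<bar> \<le> measure_pmf.expectation p (\<lambda>x. \<bar>f x\<bar>)"
    by (rule integral_abs_bound)
  also have "\<dots> \<le> B"
    using assms by (intro measure_pmf.integral_le_const integrable_pmf_bounded[where B = B]) auto
  finally show ?thesis .
qed

text \<open>Tower property, read off from the integral over \<open>join\<close>: \<open>B\<close>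
  bounds the integrand and 1 bounds the masses of the inner measures.\<close>

lemma expectation_bind_pmf:
  fixes f :: "'b \<Rightarrow> real"
  assumes "\<And>x. \<bar>f x\<bar> \<le> B"
  shows "measure_pmf.expectation (bind_pmf p N) f =
    measure_pmf.expectation p (\<lambda>x. measure_pmf.expectation (N x) f)"
proof -
  let ?N = "\<lambda>x. measure_pmf (N x)"
  have N: "?N \<in> measure_pmf p \<rightarrow>\<^sub>M subprob_algebra (count_space UNIV)"
    by (auto simp: space_subprob_algebra intro!: measure_pmf.subprob_space_axioms)
  have "measure_pmf.expectation (bind_pmf p N) f =
      (\<integral>x. f x \<partial>join (distr (measure_pmf p) (subprob_algebra (count_space UNIV)) ?N))"
    by (simp add: measure_pmf_bind bind_nonempty''[OF N])
  also have "\<dots> = (\<integral>M. \<integral>x. f x \<partial>M \<partial>distr (measure_pmf p) (subprob_algebra (count_space UNIV)) ?N)"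
    using assms N
    by (intro integral_join[where N = "count_space UNIV" and B = B and B' = 1])
      (auto intro!: AE_I2 subprob_space.subprob_emeasure_le_1 measure_pmf.finite_measure_distr
        simp: space_subprob_algebra)
  also have "\<dots> = measure_pmf.expectation p (\<lambda>x. measure_pmf.expectation (N x) f)"
    by (rule integral_distr[OF N]) (use assms in \<open>auto intro!: integral_measurable_subprob_algebra\<close>)
  finally show ?thesis .
qed

section \<open>Discounted values as series and the Bellman equation\<close>

context
  fixes P :: "'s::countable \<Rightarrow> 'a \<Rightarrow> 's pmf" and r :: "'s \<Rightarrow> 'a \<Rightarrow> real" and l B :: real
  assumes l: "0 \<le> l" "l < 1" and r_bounded: "\<And>s a. \<bar>r s a\<bar> \<le> B"
begin

text \<open>The geometric series \<open>l ^ t * B\<close> dominates, so sum and integral can be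
  exchanged. Afterwards only the marginal law at each epoch matters, not the joint law of the
  path.\<close>

lemma policy_value_eq_suminf:
  "policy_value P r l d s =
    (\<Sum>t. l ^ t * measure_pmf.expectation (state_pmf (\<lambda>x. P x (d x)) t s) (\<lambda>x. r x (d x)))"
proof -
  interpret prob_space "path_measure P d s"
    by (rule prob_space_path_measure)
  have summable_bound: "summable (\<lambda>t. l ^ t * B)"
    using l by (intro summable_mult2 summable_geometric) auto
  have le: "\<bar>l ^ t * r x a\<bar> \<le> l ^ t * B" for t x a
    using l r_bounded[of x a] by (auto simp: abs_mult intro!: mult_left_mono)
  have meas: "(\<lambda>\<omega>. l ^ t * r (\<omega> t) (d (\<omega> t))) \<in> borel_measurable (path_measure P d s)" for t
    using measurable_compose[OF measurable_path_measure_coordinate,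
        of "\<lambda>x. l ^ t * r x (d x)" borel] by simp
  have int: "integrable (path_measure P d s) (\<lambda>\<omega>. l ^ t * r (\<omega> t) (d (\<omega> t)))" for t
    using le by (intro integrable_const_bound[where B = "l ^ t * B"] meas) auto
  have "policy_value P r l d s = (\<Sum>t. \<integral>\<omega>. l ^ t * r (\<omega> t) (d (\<omega> t)) \<partial>path_measure P d s)"
    unfolding policy_value_def
  proof (rule integral_suminf[OF int])
    show "AE \<omega> in path_measure P d s. summable (\<lambda>t. norm (l ^ t * r (\<omega> t) (d (\<omega> t))))"
      using le by (intro AE_I2 summable_comparison_test'[OF summable_bound]) auto
    have "(\<integral>\<omega>. norm (l ^ t * r (\<omega> t) (d (\<omega> t))) \<partial>path_measure P d s) \<le> l ^ t * B" for t
      using le int[of t] by (intro integral_le_const) auto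
    then show "summable (\<lambda>t. \<integral>\<omega>. norm (l ^ t * r (\<omega> t) (d (\<omega> t))) \<partial>path_measure P d s)"
      by (intro summable_comparison_test'[OF summable_bound]) auto
  qed
  then show ?thesis
    by (simp add: integral_path_measure[where f = "\<lambda>x. r x (d x)"])
qed

text \<open>The term at epoch 0 is the immediate reward. Conditioning on the first step makes every
  later term \<open>l\<close> times the expectation of the term one epoch earlier.\<close>

lemma policy_value_Bellman:
  "policy_value P r l d s =
    r s (d s) + l * measure_pmf.expectation (P s (d s)) (policy_value P r l d)"
proof -
  let ?g = "\<lambda>x. r x (d x)" and ?K = "\<lambda>x. P x (d x)"
  define e where "e t x = l ^ t * measure_pmf.expectation (state_pmf ?K t x) ?g" for t x
  have summable_bound: "summable (\<lambda>t. l ^ t * B)"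
    using l by (intro summable_mult2 summable_geometric) auto
  have e_le: "\<bar>e t x\<bar> \<le> l ^ t * B" for t x
    using l abs_expectation_pmf_le[of ?g B "state_pmf ?K t x"] r_bounded
    by (auto simp: e_def abs_mult intro!: mult_left_mono)
  have int_e: "integrable (measure_pmf p) (e t)" for p t
    using e_le by (rule integrable_pmf_bounded)
  have summable_e: "summable (\<lambda>t. e t x)" for x
    using e_le by (intro summable_comparison_test'[OF summable_bound]) auto
  have value_eq: "policy_value P r l d x = (\<Sum>t. e t x)" for x
    by (simp add: policy_value_eq_suminf e_def)
  have e_Suc: "e (Suc t) s = l * measure_pmf.expectation (?K s) (e t)" for t
    unfolding e_def state_pmf_Suc_left
    by (subst expectation_bind_pmf[where B = B]) (use r_bounded in \<open>auto simp: mult_ac\<close>)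
  have "measure_pmf.expectation (?K s) (\<lambda>x. \<bar>e t x\<bar>) \<le> l ^ t * B" for t
    using e_le int_e by (intro measure_pmf.integral_le_const) auto
  then have summable_abs: "summable (\<lambda>t. measure_pmf.expectation (?K s) (\<lambda>x. norm (e t x)))"
    by (intro summable_comparison_test'[OF summable_bound]) auto
  have AE_summable: "AE x in ?K s. summable (\<lambda>t. norm (e t x))"
    using e_le by (intro AE_I2 summable_comparison_test'[OF summable_bound]) auto
  \<comment> \<open>\<open>swap(1)\<close> exchanges sum and expectation; \<open>swap(2)\<close> is
    the convergence required for pulling \<open>l\<close> out of the series.\<close>
  note swap = integral_suminf[OF int_e AE_summable summable_abs]
    summable_integral[OF int_e AE_summable summable_abs]
  have "(\<Sum>t. e t s) = (\<Sum>t. e (Suc t) s) + e 0 s"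
    using suminf_split_head[OF summable_e[of s]] by simp
  also have "(\<Sum>t. e (Suc t) s) = l * measure_pmf.expectation (?K s) (\<lambda>x. \<Sum>t. e t x)"
    unfolding e_Suc swap(1) by (rule suminf_mult[OF swap(2)])
  also have "e 0 s = ?g s"
    by (simp add: e_def)
  finally show ?thesis
    by (simp add: value_eq[abs_def] add.commute)
qed

end

section \<open>A discounted maximum principle\<close>

text \<open>Where \<open>u\<close> attains its maximum \<open>m\<close> over \<open>S\<close>, the
  hypothesis yields \<open>m \<le> l * m\<close>, which is impossible for positive \<open>m\<close>
  since \<open>l < 1\<close>. It serves to compare a policy value with the candidate value, in both
  directions.\<close>

lemma nonpos_if_le_discounted_expectation:
  fixes u :: "'s \<Rightarrow> real"
  assumes "finite S" "0 \<le> l" "l < 1"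
    and closed: "\<And>s. s \<in> S \<Longrightarrow> set_pmf (K s) \<subseteq> S"
    and le: "\<And>s. s \<in> S \<Longrightarrow> u s \<le> l * measure_pmf.expectation (K s) u"
    and "s \<in> S"
  shows "u s \<le> 0"
proof -
  define m where "m = Max (u ` S)"
  have u_le: "u x \<le> m" if "x \<in> S" for x
    using that \<open>finite S\<close> by (simp add: m_def)
  have "m \<in> u ` S"
    unfolding m_def using \<open>finite S\<close> \<open>s \<in> S\<close> by (intro Max_in) auto
  then obtain x where x: "x \<in> S" "m = u x"
    by blast
  have "measure_pmf.expectation (K x) u \<le> m"
    using closed[OF x(1)] u_le \<open>finite S\<close>
    by (intro measure_pmf.integral_le_const integrable_measure_pmf_finite)
      (auto simp: AE_measure_pmf_iff intro: finite_subset)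
  then have "m \<le> l * m"
    using le[OF x(1)] \<open>0 \<le> l\<close> x(2) by (auto intro: order_trans mult_left_mono)
  then have "m \<le> 0"
    using \<open>l < 1\<close> by (smt (verit) mult_le_cancel_right1)
  then show ?thesis
    using u_le[OF \<open>s \<in> S\<close>] by simp
qed

section \<open>Expectations under laws given by lists\<close>

lemma expectation_pmf_of_list:
  fixes f :: "'a \<Rightarrow> real"
  assumes "pmf_of_list_wf xs"
  shows "measure_pmf.expectation (pmf_of_list xs) f = (\<Sum>(x, w)\<leftarrow>xs. w * f x)"
proof -
  \<comment> \<open>\<open>A\<close> stays fixed and may exceed the points of \<open>ys\<close>, so
    the induction need not track whether a new head repeats an earlier point.\<close>
  have sum_eq: "(\<Sum>a\<in>A. f a * sum_list (map snd (filter (\<lambda>z. fst z = a) ys))) =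
      (\<Sum>(x, w)\<leftarrow>ys. w * f x)" if "finite A" "fst ` set ys \<subseteq> A" for A and ys :: "('a \<times> real) list"
    using that(2)
  proof (induction ys)
    case (Cons y ys)
    have "(\<Sum>a\<in>A. f a * sum_list (map snd (filter (\<lambda>z. fst z = a) (y # ys)))) =
        (\<Sum>a\<in>A. (if fst y = a then f a * snd y else 0) +
          f a * sum_list (map snd (filter (\<lambda>z. fst z = a) ys)))"
      by (intro sum.cong) (auto simp: algebra_simps)
    then show ?case
      using Cons \<open>finite A\<close> by (simp add: sum.distrib split_beta)
  qed simp
  have "measure_pmf.expectation (pmf_of_list xs) f =
      (\<Sum>a\<in>fst ` set xs. f a * pmf (pmf_of_list xs) a)"
    using set_pmf_of_list[OF assms] by (intro integral_measure_pmf_real) auto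
  then show ?thesis
    by (simp add: pmf_pmf_of_list[OF assms] sum_eq)
qed

lemma expectation_pmf_of_list2:
  fixes f :: "'a \<Rightarrow> real"
  assumes "0 \<le> a" "0 \<le> b" "a + b = 1"
  shows "measure_pmf.expectation (pmf_of_list [(x, a), (y, b)]) f = a * f x + b * f y"
  using assms by (subst expectation_pmf_of_list) (auto simp: pmf_of_list_wf_def)

lemma expectation_pmf_of_list3:
  fixes f :: "'a \<Rightarrow> real"
  assumes "0 \<le> a" "0 \<le> b" "0 \<le> c" "a + b + c = 1"
  shows "measure_pmf.expectation (pmf_of_list [(x, a), (y, b), (z, c)]) f =
    a * f x + b * f y + c * f z"
  using assms by (subst expectation_pmf_of_list) (auto simp: pmf_of_list_wf_def)

section \<open>The candidate value function\<close>

lemma finite_states: "finite (states L)"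
  by (simp add: states_def)

text \<open>
  A geometric waiting time with success probability \<open>q\<close> has expected discount
  \<open>q l / (1 - (1 - q) l)\<close>; here \<open>q = 6/7\<close> for the last step \<open>L - 2 \<rightarrow> L\<close> and \<open>q = 5/7\<close> for the others.
\<close>

definition side_value :: "nat \<Rightarrow> real \<Rightarrow> nat \<Rightarrow> real" where
  "side_value L l i =
    (if i = L then 1 else 6 * l / (7 - l) * (5 * l / (7 - 2 * l)) ^ (L - 2 - i))"

text \<open>\<open>1 / (1 - l)\<close> is the value of collecting reward 1 forever at
  \<open>(L, L)\<close>. At \<open>(2, 2)\<close> only \<open>B1'\<close> and \<open>B2'\<close> are
  admissible, so the first growth step has success probability 1/2, with discount
  \<open>l / (2 - l)\<close>. If \<open>L = 4\<close> that step leads directly from 2 to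
  \<open>L\<close> with probability 2/3, with discount \<open>2 * l / (3 - l)\<close>.\<close>

definition opt_value :: "nat \<Rightarrow> real \<Rightarrow> nat \<times> nat \<Rightarrow> real" where
  "opt_value L l s =
    (if s = (2, 2) then
       if L = 4 then 2 * l / (3 - l) * side_value L l 2 / (1 - l)
       else l / (2 - l) * (side_value L l 2 * side_value L l 3) / (1 - l)
     else side_value L l (fst s) * side_value L l (snd s) / (1 - l))"

lemma opt_value_eq:
  "(i, j) \<noteq> (2, 2) \<Longrightarrow> opt_value L l (i, j) = side_value L l i * side_value L l j / (1 - l)"
  by (auto simp: opt_value_def)

section \<open>One-step equations and inequalities for a single side\<close>

context
  fixes L :: nat and l :: real
  assumes L: "4 \<le> L" and l: "0 < l" "l < 1"
begin

private abbreviation "f \<equiv> side_value L l"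
private abbreviation "W \<equiv> opt_value L l"

lemma side_value_pos: "0 < f i"
  using l by (auto simp: side_value_def intro!: mult_pos_pos divide_pos_pos zero_less_power)

lemma side_value_L: "f L = 1"
  by (simp add: side_value_def)

lemma side_value_inner:
  assumes "2 \<le> j" "j \<le> L - 3"
  shows "(7 - 2 * l) * f j = 5 * l * f (j + 1)"
proof -
  have "L - 2 - j = Suc (L - 2 - (j + 1))"
    using assms L by simp
  moreover have "j \<noteq> L" "j + 1 \<noteq> L"
    using assms L by auto
  ultimately show ?thesis
    using l by (simp add: side_value_def)
qed

lemma side_value_last: "(7 - l) * f (L - 2) = 6 * l"
  using L l by (simp add: side_value_def)

text \<open>Fixed-point equation of the discounted waiting time under \<open>B1\<close> or
  \<open>B2\<close>: stay with probability 2/7, grow with probability 5/7.\<close>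

lemma side_value_B_inner:
  "2 \<le> j \<Longrightarrow> j \<le> L - 3 \<Longrightarrow> l * (2 / 7 * f j + 5 / 7 * f (j + 1)) = f j"
  using side_value_inner[of j] by (simp add: algebra_simps)

lemma side_value_B_last: "l * (1 / 7 * f (L - 2) + 6 / 7) = f (L - 2)"
  using side_value_last by (simp add: algebra_simps)

text \<open>By \<open>side_value_inner\<close>, each left side is a convex combination of
  \<open>f j\<close> and the strictly smaller \<open>l * f j\<close>. The weight 2/3 is the 1/2 for
  staying plus the 1/6 of the corner move, which preserves the product.\<close>

lemma side_value_B'_inner:
  assumes "2 \<le> j" "j \<le> L - 3"
  shows "l * (1 / 2 * f j + 1 / 2 * f (j + 1)) < f j"
    and "l * (2 / 3 * f j + 1 / 3 * f (j + 1)) < f j"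
proof -
  have *: "l * f (j + 1) = (7 * f j - 2 * l * f j) / 5"
    using side_value_inner[OF assms] by (simp add: algebra_simps)
  have less: "l * f j < f j"
    using l side_value_pos[of j] by simp
  show "l * (1 / 2 * f j + 1 / 2 * f (j + 1)) < f j" "l * (2 / 3 * f j + 1 / 3 * f (j + 1)) < f j"
    using * less by (simp_all add: algebra_simps)
qed

lemma side_value_B'_last: "l * (1 / 3 * f (L - 2) + 2 / 3) < f (L - 2)"
proof -
  have "l * f (L - 2) < f (L - 2)"
    using l side_value_pos[of "L - 2"] by simp
  then show ?thesis
    using side_value_last by (simp add: algebra_simps)
qed

text \<open>Moving one unit between two sides that stay below \<open>L\<close> keeps the total
  number of remaining growth steps, so the exponents have equal sums.\<close>

lemma side_value_diagonal:
  assumes "2 \<le> j" "j < i" "i \<le> L - 2"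
  shows "f (i - 1) * f (j + 1) = f i * f j"
proof -
  have "L - 2 - (i - 1) + (L - 2 - (j + 1)) = (L - 2 - i) + (L - 2 - j)"
    using assms by simp
  then have "c ^ (L - 2 - (i - 1)) * c ^ (L - 2 - (j + 1)) = c ^ (L - 2 - i) * c ^ (L - 2 - j)"
    for c :: real
    by (simp flip: power_add)
  moreover have "i - 1 \<noteq> L" "j + 1 \<noteq> L" "i \<noteq> L" "j \<noteq> L"
    using assms L by auto
  ultimately show ?thesis
    by (simp add: side_value_def)
qed

lemma mem_states_iff:
  "(i, j) \<in> states L \<longleftrightarrow> (2 \<le> i \<and> i \<le> L - 2 \<or> i = L) \<and> (2 \<le> j \<and> j \<le> L - 2 \<or> j = L)"
  using L by (auto simp: states_def)

section \<open>Action values against the candidate\<close>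

private abbreviation "Q s a \<equiv> l * measure_pmf.expectation (transition L s a) W"

text \<open>Side \<open>i\<close> does not change, so its factor pulls out and the fixed-point
  equation for side \<open>j\<close> remains.\<close>

lemma Q_B1:
  assumes "3 \<le> i \<and> i \<le> L - 2 \<or> i = L" "2 \<le> j" "j \<le> L - 2"
  shows "Q (i, j) B1 = W (i, j)"
proof -
  \<comment> \<open>Keeps the state and its successors away from \<open>(2, 2)\<close>, the one
    state where \<open>opt_value\<close> is not given by the product formula.\<close>
  have i2: "i \<noteq> 2" using assms L by auto
  show ?thesis
  proof (cases "j = L - 2")
    case True
    then have "Q (i, j) B1 = f i / (1 - l) * (l * (1 / 7 * f (L - 2) + 6 / 7))"
      using assms L i2
      by (auto simp: expectation_pmf_of_list2 opt_value_eq side_value_L algebra_simps add_divide_distrib)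
    then show ?thesis
      unfolding side_value_B_last using True i2 by (simp add: opt_value_eq)
  next
    case False
    then have j: "j \<le> L - 3" using assms by simp
    then have "Q (i, j) B1 = f i / (1 - l) * (l * (2 / 7 * f j + 5 / 7 * f (j + 1)))"
      using assms L i2
      by (auto simp: expectation_pmf_of_list2 opt_value_eq algebra_simps add_divide_distrib)
    then show ?thesis
      unfolding side_value_B_inner[OF assms(2) j] using i2 by (simp add: opt_value_eq)
  qed
qed

lemma Q_B2:
  assumes "3 \<le> j \<and> j \<le> L - 2 \<or> j = L" "2 \<le> i" "i \<le> L - 2"
  shows "Q (i, j) B2 = W (i, j)"
proof -
  have j2: "j \<noteq> 2" using assms L by auto
  show ?thesis
  proof (cases "i = L - 2")
    case True
    then have "Q (i, j) B2 = f j / (1 - l) * (l * (1 / 7 * f (L - 2) + 6 / 7))"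
      using assms L j2
      by (auto simp: expectation_pmf_of_list2 opt_value_eq side_value_L algebra_simps add_divide_distrib)
    then show ?thesis
      unfolding side_value_B_last using True j2 by (simp add: opt_value_eq)
  next
    case False
    then have i: "i \<le> L - 3" using assms by simp
    then have "Q (i, j) B2 = f j / (1 - l) * (l * (2 / 7 * f i + 5 / 7 * f (i + 1)))"
      using assms L j2
      by (auto simp: expectation_pmf_of_list2 opt_value_eq algebra_simps add_divide_distrib)
    then show ?thesis
      unfolding side_value_B_inner[OF assms(2) i] using j2 by (simp add: opt_value_eq)
  qed
qed

text \<open>In every row of the transition table the positive factor of side \<open>i\<close> splits
  off, leaving a strict inequality for side \<open>j\<close> alone.\<close>

lemma Q_B1'_less:
  assumes "2 \<le> i" "i \<le> L - 2" "2 \<le> j" "j \<le> L - 2" "(i, j) \<noteq> (2, 2)"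
  shows "Q (i, j) B1' < W (i, j)"
proof -
  have pos: "0 < f i / (1 - l)"
    using l side_value_pos[of i] by simp
  consider "j = L - 2" | "i \<le> j" "j \<le> L - 3" | "j < i" "j \<le> L - 3"
    using assms by linarith
  then obtain x where "Q (i, j) B1' = f i / (1 - l) * x" "x < f j"
  proof cases
    case 1
    have "Q (i, j) B1' = f i / (1 - l) * (l * (1 / 3 * f (L - 2) + 2 / 3))"
      using 1 assms L
      by (auto simp: expectation_pmf_of_list2 opt_value_eq side_value_L algebra_simps add_divide_distrib)
    with side_value_B'_last 1 show ?thesis by (intro that) auto
  next
    case 2
    have "Q (i, j) B1' = f i / (1 - l) * (l * (1 / 2 * f j + 1 / 2 * f (j + 1)))"
      using 2 assms L
      by (auto simp: expectation_pmf_of_list2 opt_value_eq algebra_simps add_divide_distrib)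
    with side_value_B'_inner(1)[of j] 2 assms show ?thesis by (intro that) auto
  next
    case 3
    \<comment> \<open>Since \<open>j + 1\<close> is at least 3, the corner move does not end in
      \<open>(2, 2)\<close>, and both values are products.\<close>
    have diag: "W (i - 1, j + 1) = W (i, j)"
      using 3 assms side_value_diagonal[of j i] by (subst (1 2) opt_value_eq) auto
    have "Q (i, j) B1' = l * (1 / 2 * W (i, j) + 1 / 3 * W (i, j + 1) + 1 / 6 * W (i - 1, j + 1))"
      using 3 assms L by (auto simp: expectation_pmf_of_list3)
    \<comment> \<open>In value the corner move amounts to staying put: 1/2 + 1/6 = 2/3.\<close>
    also have "\<dots> = l * (2 / 3 * W (i, j) + 1 / 3 * W (i, j + 1))"
      unfolding diag by simp
    also have "\<dots> = f i / (1 - l) * (l * (2 / 3 * f j + 1 / 3 * f (j + 1)))"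
      using 3 assms by (simp add: opt_value_eq algebra_simps add_divide_distrib)
    finally show ?thesis
      using side_value_B'_inner(2)[of j] 3 assms by (intro that) auto
  qed
  moreover have "W (i, j) = f i / (1 - l) * f j"
    using assms by (simp add: opt_value_eq)
  ultimately show ?thesis
    using mult_strict_left_mono[OF _ pos] by simp
qed

lemma Q_B2'_less:
  assumes "2 \<le> i" "i \<le> L - 2" "2 \<le> j" "j \<le> L - 2" "(i, j) \<noteq> (2, 2)"
  shows "Q (i, j) B2' < W (i, j)"
proof -
  have pos: "0 < f j / (1 - l)"
    using l side_value_pos[of j] by simp
  consider "i = L - 2" | "j \<le> i" "i \<le> L - 3" | "i < j" "i \<le> L - 3"
    using assms by linarith
  then obtain x where "Q (i, j) B2' = f j / (1 - l) * x" "x < f i"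
  proof cases
    case 1
    have "Q (i, j) B2' = f j / (1 - l) * (l * (1 / 3 * f (L - 2) + 2 / 3))"
      using 1 assms L
      by (auto simp: expectation_pmf_of_list2 opt_value_eq side_value_L algebra_simps add_divide_distrib)
    with side_value_B'_last 1 show ?thesis by (intro that) auto
  next
    case 2
    have "Q (i, j) B2' = f j / (1 - l) * (l * (1 / 2 * f i + 1 / 2 * f (i + 1)))"
      using 2 assms L
      by (auto simp: expectation_pmf_of_list2 opt_value_eq algebra_simps add_divide_distrib)
    with side_value_B'_inner(1)[of i] 2 assms show ?thesis by (intro that) auto
  next
    case 3
    \<comment> \<open>The diagonal identity with the sides exchanged, \<open>j\<close> being the
      longer one here.\<close>
    have diag: "W (i + 1, j - 1) = W (i, j)"
      using 3 assms side_value_diagonal[of i j] by (subst (1 2) opt_value_eq) (auto simp: mult.commute)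
    have "Q (i, j) B2' = l * (1 / 2 * W (i, j) + 1 / 3 * W (i + 1, j) + 1 / 6 * W (i + 1, j - 1))"
      using 3 assms L by (auto simp: expectation_pmf_of_list3)
    also have "\<dots> = l * (2 / 3 * W (i, j) + 1 / 3 * W (i + 1, j))"
      unfolding diag by simp
    also have "\<dots> = f j / (1 - l) * (l * (2 / 3 * f i + 1 / 3 * f (i + 1)))"
      using 3 assms by (simp add: opt_value_eq algebra_simps add_divide_distrib)
    finally show ?thesis
      using side_value_B'_inner(2)[of i] 3 assms by (intro that) auto
  qed
  moreover have "W (i, j) = f j / (1 - l) * f i"
    using assms by (simp add: opt_value_eq)
  ultimately show ?thesis
    using mult_strict_left_mono[OF _ pos] by simp
qed

text \<open>By symmetry of the product both actions grow into states of equal value, and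
  \<open>W (2, 2)\<close> solves the resulting waiting-time equation. This tie is why
  \<open>(2, 2)\<close> stays unconstrained.\<close>

lemma Q_2_2:
  assumes "a \<in> {B1', B2'}"
  shows "Q (2, 2) a = W (2, 2)"
proof (cases "L = 4")
  case True
  have W: "W (2, 2) = 2 * l / (3 - l) * f 2 / (1 - l)" "W (2, 4) = f 2 / (1 - l)" "W (4, 2) = f 2 / (1 - l)"
    using True side_value_L by (simp_all add: opt_value_def)
  have Q: "Q (2, 2) a = l * (1 / 3 * W (2, 2) + 2 / 3 * (f 2 / (1 - l)))"
    using True assms W by (auto simp: expectation_pmf_of_list2)
  have "(3 - l) * W (2, 2) = 2 * l * (f 2 / (1 - l))"
    unfolding W using l by simp
  moreover have "l * (1 / 3 * w + 2 / 3 * x) = w" if "(3 - l) * w = 2 * l * x" for w x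
    using that by (simp add: algebra_simps)
  ultimately show ?thesis
    unfolding Q by blast
next
  case False
  with L have L5: "2 \<le> L - 2" "2 \<le> L - 3" by simp_all
  have W: "W (2, 2) = l / (2 - l) * (f 2 * f 3) / (1 - l)"
    "W (2, 3) = f 2 * f 3 / (1 - l)" "W (3, 2) = f 2 * f 3 / (1 - l)"
    using False by (simp_all add: opt_value_def)
  have Q: "Q (2, 2) a = l * (1 / 2 * W (2, 2) + 1 / 2 * (f 2 * f 3 / (1 - l)))"
    using L5 assms W(2,3) by (auto simp: expectation_pmf_of_list2)
  have "(2 - l) * W (2, 2) = l * (f 2 * f 3 / (1 - l))"
    unfolding W using l by simp
  moreover have "l * (1 / 2 * w + 1 / 2 * x) = w" if "(2 - l) * w = l * x" for w x
    using that by (simp add: algebra_simps)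
  ultimately show ?thesis
    unfolding Q by blast
qed

text \<open>The inequality bounds every policy from above; the equality clause later turns equality
  of values back into a constraint on the chosen action.\<close>

lemma opt_value_Bellman:
  assumes "s \<in> states L" "a \<in> actions L s"
  shows "reward1 L s a + Q s a \<le> W s"
    and "reward1 L s a + Q s a = W s \<longleftrightarrow> s = (2, 2) \<or> a \<in> A_star L s"
proof -
  obtain i j where s: "s = (i, j)" by fastforce
  consider "s = (L, L)" | "s = (2, 2)" | "s \<noteq> (L, L)" "s \<noteq> (2, 2)" "a \<in> A_star L s"
    | "s \<noteq> (2, 2)" "a \<notin> A_star L s"
    by blast
  then have "reward1 L s a + Q s a \<le> W s \<and>
    (reward1 L s a + Q s a = W s \<longleftrightarrow> s = (2, 2) \<or> a \<in> A_star L s)"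
  proof cases
    case 1
    then have "W s = 1 / (1 - l)"
      using L by (simp add: opt_value_eq side_value_L)
    then have "1 + l * W s = W s"
      using l by (simp add: field_simps)
    then show ?thesis
      using assms 1 by (simp add: reward1_def)
  next
    case 2
    then show ?thesis
      using assms Q_2_2[of a] L by (auto simp: reward1_def)
  next
    case 3
    \<comment> \<open>Admissibility excludes \<open>B1\<close> when \<open>i = 2\<close> and
      \<open>B2\<close> when \<open>j = 2\<close>, which supplies the lower bound 3 in
      \<open>Q_B1\<close> and \<open>Q_B2\<close>.\<close>
    then have "Q s a = W s"
      using assms L Q_B1[of i j] Q_B2[of j i] unfolding s mem_states_iff
      by (auto simp del: transition.simps split: if_splits)
    with 3 show ?thesis
      by (simp add: reward1_def)
  next
    case 4
    \<comment> \<open>If a side equals \<open>L\<close>, the only admissible action lies in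
      \<open>A_star\<close>; so what remains is \<open>B1'\<close> or \<open>B2'\<close> with both
      sides below \<open>L\<close>.\<close>
    then have "s \<noteq> (L, L)" "Q s a < W s"
      using assms L Q_B1'_less[of i j] Q_B2'_less[of i j] unfolding s mem_states_iff
      by (auto simp del: transition.simps split: if_splits)
    with 4 show ?thesis
      by (simp add: reward1_def)
  qed
  then show "reward1 L s a + Q s a \<le> W s"
    "reward1 L s a + Q s a = W s \<longleftrightarrow> s = (2, 2) \<or> a \<in> A_star L s"
    by auto
qed

section \<open>Policy values against the candidate\<close>

private abbreviation "v \<equiv> policy_value (transition L) (reward1 L) l"
private abbreviation "E s a \<equiv> measure_pmf.expectation (transition L s a)"

lemma value_Bellman: "v d s = reward1 L s (d s) + l * E s (d s) (v d)"
  using l by (intro policy_value_Bellman[where B = 1]) (auto simp: reward1_def)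

lemma integrable_transition: "s \<in> states L \<Longrightarrow> integrable (transition L s a) (u :: _ \<Rightarrow> real)"
  using finite_subset[OF set_transition_subset_states[OF L] finite_states]
  by (rule integrable_measure_pmf_finite)

text \<open>Subtracting the optimality inequality from the Bellman equation of \<open>d\<close>
  cancels the reward, and the maximum principle applies to the difference.\<close>

lemma policy_value_le_opt_value:
  assumes "d \<in> decision_rules (states L) (actions L)" "s \<in> states L"
  shows "v d s \<le> W s"
proof -
  have "v d x - W x \<le> l * E x (d x) (\<lambda>y. v d y - W y)" if x: "x \<in> states L" for x
  proof -
    have "d x \<in> actions L x"
      using assms x by (auto simp: decision_rules_def)
    then have "reward1 L x (d x) + l * E x (d x) W \<le> W x"
      using opt_value_Bellman(1)[OF x] by blast
    then show ?thesis
      using value_Bellman[of d x] integrable_transition[OF x] by (simp add: right_diff_distrib)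
  qed
  then have "v d s - W s \<le> 0"
    using l assms(2) set_transition_subset_states[OF L]
    by (intro nonpos_if_le_discounted_expectation[where K = "\<lambda>x. transition L x (d x)"
          and u = "\<lambda>x. v d x - W x", OF finite_states]) auto
  then show ?thesis by simp
qed

text \<open>The optimality inequality is now an equality in every state, also at
  \<open>(2, 2)\<close> for either action, so the comparison runs with the opposite sign.\<close>

lemma opt_value_le_policy_value:
  assumes d: "d \<in> decision_rules (states L) (actions L)"
    and A: "\<And>s. s \<in> states L \<Longrightarrow> s \<noteq> (2, 2) \<Longrightarrow> d s \<in> A_star L s"
    and "s \<in> states L"
  shows "W s \<le> v d s"
proof -
  have "W x - v d x \<le> l * E x (d x) (\<lambda>y. W y - v d y)" if x: "x \<in> states L" for x
  proof -
    have "d x \<in> actions L x"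
      using d x by (auto simp: decision_rules_def)
    then have "reward1 L x (d x) + l * E x (d x) W = W x"
      using opt_value_Bellman(2)[OF x] A[OF x] by blast
    then show ?thesis
      using value_Bellman[of d x] integrable_transition[OF x] by (simp add: right_diff_distrib)
  qed
  then have "W s - v d s \<le> 0"
    using l assms(3) set_transition_subset_states[OF L]
    by (intro nonpos_if_le_discounted_expectation[where K = "\<lambda>x. transition L x (d x)"
          and u = "\<lambda>x. W x - v d x", OF finite_states]) auto
  then show ?thesis by simp
qed

text \<open>Such a rule attains the bound \<open>W\<close>, which forces the value of any optimal
  policy to be \<open>W\<close>.\<close>

lemma ex_A_star_decision_rule:
  obtains d where "d \<in> decision_rules (states L) (actions L)"
    "\<And>s. s \<in> states L \<Longrightarrow> s \<noteq> (2, 2) \<Longrightarrow> d s \<in> A_star L s"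
proof -
  have "\<exists>a. a \<in> actions L s \<and> (s \<noteq> (2, 2) \<longrightarrow> a \<in> A_star L s)" if "s \<in> states L" for s
  proof (cases "s = (2, 2)")
    case True
    then show ?thesis using L by (auto intro: exI[of _ "B1'"])
  next
    case False
    then show ?thesis using A_star_Int_actions_eq_empty_iff[OF L that] by blast
  qed
  then obtain d where "\<forall>s\<in>states L. d s \<in> actions L s \<and> (s \<noteq> (2, 2) \<longrightarrow> d s \<in> A_star L s)"
    by metis
  then show ?thesis
    by (intro that[of d]) (auto simp: decision_rules_def)
qed

end

section \<open>Characterization of optimal decision rules\<close>

theorem theorem2p2:
  fixes L :: nat and l :: real and d :: "nat \<times> nat \<Rightarrow> action"
  assumes "4 \<le> L"
    and "0 < l" and "l < 1"
    and "d \<in> decision_rules (states L) (actions L)"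
  shows "optimal_policy (states L) (actions L) (transition L) (reward1 L) l d \<longleftrightarrow>
    (\<forall>s\<in>states L. s \<noteq> (2, 2) \<longrightarrow> d s \<in> A_star L s)"
proof
  let ?v = "policy_value (transition L) (reward1 L) l" and ?W = "opt_value L l"
  note le_opt = policy_value_le_opt_value[OF assms(1-3)]
    and opt_le = opt_value_le_policy_value[OF assms(1-3)]
  {
    assume "\<forall>s\<in>states L. s \<noteq> (2, 2) \<longrightarrow> d s \<in> A_star L s"
    then have "?W s \<le> ?v d s" if "s \<in> states L" for s
      using opt_le[OF assms(4) _ that] by blast
    then show "optimal_policy (states L) (actions L) (transition L) (reward1 L) l d"
      unfolding optimal_policy_def using assms(4) le_opt order_trans by blast
  next
    assume opt: "optimal_policy (states L) (actions L) (transition L) (reward1 L) l d"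
    obtain d' where d': "d' \<in> decision_rules (states L) (actions L)"
      "\<And>s. s \<in> states L \<Longrightarrow> s \<noteq> (2, 2) \<Longrightarrow> d' s \<in> A_star L s"
      using ex_A_star_decision_rule[OF assms(1-3)] by blast
    have eq: "?v d s = ?W s" if "s \<in> states L" for s
    proof (rule antisym)
      show "?v d s \<le> ?W s"
        using assms(4) that by (rule le_opt)
      have "?W s \<le> ?v d' s"
        using d' that by (rule opt_le)
      also have "\<dots> \<le> ?v d s"
        using opt d'(1) that by (simp add: optimal_policy_def)
      finally show "?W s \<le> ?v d s" .
    qed
    show "\<forall>s\<in>states L. s \<noteq> (2, 2) \<longrightarrow> d s \<in> A_star L s"
    proof (intro ballI impI)
      fix s assume s: "s \<in> states L" "s \<noteq> (2, 2)"
      \<comment> \<open>Successors stay in \<open>states L\<close>, where the two functions agree.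
        The Bellman equation of \<open>d\<close> thus becomes an equality in the optimality
        equation, which away from \<open>(2, 2)\<close> holds only for actions in
        \<open>A_star\<close>.\<close>
      have "measure_pmf.expectation (transition L s (d s)) (?v d) =
          measure_pmf.expectation (transition L s (d s)) ?W"
        using set_transition_subset_states[OF assms(1) s(1), of "d s"] eq
        by (intro integral_cong_AE) (auto simp: AE_measure_pmf_iff)
      then have "reward1 L s (d s) +
          l * measure_pmf.expectation (transition L s (d s)) ?W = ?W s"
        using value_Bellman[OF assms(1-3), of d s] eq[OF s(1)] by simp
      moreover have "d s \<in> actions L s"
        using assms(4) s(1) by (auto simp: decision_rules_def)
      ultimately show "d s \<in> A_star L s"
        using opt_value_Bellman(2)[OF assms(1-3) s(1)] s(2) by blast
    qed
  }
qed

end
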